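(* Assume $\alpha=\gamma$ and $\alpha+\beta>1$, and let $c\in(0,1)$ satisfy \[\left(\frac{\beta}{c}\right)^c\left(\frac{\alpha}{1-c}\right)^{1-c}=\frac12 .\] If $\alpha<1/2$, then a.a.s. $K(n,P)$ contains an edge connecting two vertices $u,w$ with $H(u,w)=cn+\log^2 n$. If $\beta<1/2$, then a.a.s. $K(n,P)$ contains an edge connecting two vertices $u,w$ with $H(u,w)=cn-\log^2 n$.
   Context: Let $0<\alpha,\beta,\gamma<1$ be constants not depending on $n$, and $P=\begin{pmatrix}\alpha&\beta\\ \beta&\gamma\end{pmatrix}$ indexed by $\{0,1\}$ ($P_{1,1}=\alpha$, $P_{0,1}=P_{1,0}=\beta$, $P_{0,0}=\gamma$). The stochastic Kronecker graph $K(n,P)$ has vertex set $\mathbb Z_2^n$; writing $u_k$ for the $k$-th digit of $u$, each pair $\{u,v\}$ is an edge with probability $p_{u,v}=\prod_{k=1}^n P_{u_k,v_k}$, independently of all other pairs. $H(u,w)$ is the Hamming distance between $u$ and $w$. Floors and ceilings are ignored (non-integer distances are rounded). A.a.s. means with probability tending to $1$ as $n\to\infty$. *)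

theory Defs
  imports "HOL-Probability.Probability" "HOL-Library.Z2"
begin

definition kron_matrix :: "real \<Rightarrow> real \<Rightarrow> real \<Rightarrow> bit \<Rightarrow> bit \<Rightarrow> real" where
  "kron_matrix \<alpha> \<beta> \<gamma> i j =
     (if i = 1 \<and> j = 1 then \<alpha> else if i = 0 \<and> j = 0 then \<gamma> else \<beta>)"

definition kron_vertices :: "nat \<Rightarrow> (nat \<Rightarrow> bit) set" where
  "kron_vertices n = {1..n} \<rightarrow>\<^sub>E UNIV"

definition kron_pairs :: "nat \<Rightarrow> (nat \<Rightarrow> bit) set set" where
  "kron_pairs n = {e. e \<subseteq> kron_vertices n \<and> card e = 2}"

definition hamming :: "nat \<Rightarrow> (nat \<Rightarrow> bit) \<Rightarrow> (nat \<Rightarrow> bit) \<Rightarrow> nat" where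
  "hamming n u w = card {k \<in> {1..n}. u k \<noteq> w k}"

definition kron_prob ::
    "nat \<Rightarrow> (bit \<Rightarrow> bit \<Rightarrow> real) \<Rightarrow> (nat \<Rightarrow> bit) \<Rightarrow> (nat \<Rightarrow> bit) \<Rightarrow> real" where
  "kron_prob n P u v = (\<Prod>k=1..n. P (u k) (v k))"

(* The edge probability as a function of the unordered pair; well defined for
   symmetric P, see kron_pair_prob_doubleton. *)
definition kron_pair_prob ::
    "nat \<Rightarrow> (bit \<Rightarrow> bit \<Rightarrow> real) \<Rightarrow> (nat \<Rightarrow> bit) set \<Rightarrow> real" where
  "kron_pair_prob n P e = (THE p. \<exists>u v. e = {u, v} \<and> p = kron_prob n P u v)"

(* The law of the edge set of K(n,P): one independent Bernoulli variable for each
   pair of distinct vertices. *)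
definition kronecker_graph ::
    "nat \<Rightarrow> (bit \<Rightarrow> bit \<Rightarrow> real) \<Rightarrow> (nat \<Rightarrow> bit) set set pmf" where
  "kronecker_graph n P =
     map_pmf (\<lambda>X. {e \<in> kron_pairs n. X e})
       (Pi_pmf (kron_pairs n) False (\<lambda>e. bernoulli_pmf (kron_pair_prob n P e)))"

definition aas :: "(nat \<Rightarrow> 'a pmf) \<Rightarrow> (nat \<Rightarrow> 'a \<Rightarrow> bool) \<Rightarrow> bool" where
  "aas M A \<longleftrightarrow> (\<lambda>n. measure_pmf.prob (M n) {G. A n G}) \<longlonglongrightarrow> 1"

definition has_edge_at_distance :: "nat \<Rightarrow> int \<Rightarrow> (nat \<Rightarrow> bit) set set \<Rightarrow> bool" where
  "has_edge_at_distance n d E \<longleftrightarrow>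
     (\<exists>u \<in> kron_vertices n. \<exists>w \<in> kron_vertices n. {u, w} \<in> E \<and> int (hamming n u w) = d)"

(* d n is x n rounded to an integer; the direction may depend on n. *)
definition is_rounding :: "(nat \<Rightarrow> int) \<Rightarrow> (nat \<Rightarrow> real) \<Rightarrow> bool" where
  "is_rounding d x \<longleftrightarrow> (\<forall>n. d n = \<lfloor>x n\<rfloor> \<or> d n = \<lceil>x n\<rceil>)"

lemma kron_matrix_commute: "kron_matrix \<alpha> \<beta> \<gamma> i j = kron_matrix \<alpha> \<beta> \<gamma> j i"
  by (auto simp: kron_matrix_def)

lemma UNIV_bit: "(UNIV :: bit set) = {0, 1}"
proof -
  have "x \<in> {0, 1}" for x :: bit
    by (cases x) auto
  then show ?thesis by blast
qed

lemma finite_UNIV_bit: "finite (UNIV :: bit set)"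
  by (simp add: UNIV_bit)

lemma finite_kron_vertices: "finite (kron_vertices n)"
  unfolding kron_vertices_def using finite_UNIV_bit by (intro finite_PiE) auto

lemma card_kron_vertices: "card (kron_vertices n) = 2 ^ n"
proof -
  have "card (UNIV :: bit set) = 2"
    by (simp add: UNIV_bit)
  then show ?thesis
    by (simp add: kron_vertices_def card_PiE)
qed

lemma finite_kron_pairs: "finite (kron_pairs n)"
  by (rule finite_subset[of _ "Pow (kron_vertices n)"])
     (auto simp: kron_pairs_def finite_kron_vertices)

lemma kron_pair_prob_doubleton:
  assumes "\<And>i j. P i j = P j i"
  shows "kron_pair_prob n P {u, v} = kron_prob n P u v"
proof -
  have sym: "kron_prob n P v u = kron_prob n P u v"
    unfolding kron_prob_def by (rule prod.cong) (auto intro: assms)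
  show ?thesis
    unfolding kron_pair_prob_def
    by (rule the_equality) (use sym in \<open>auto simp: doubleton_eq_iff\<close>)
qed

lemma prob_edge_kronecker_graph:
  assumes "0 < \<alpha>" "\<alpha> < 1" "0 < \<beta>" "\<beta> < 1" "0 < \<gamma>" "\<gamma> < 1"
    and "u \<in> kron_vertices n" "v \<in> kron_vertices n" "u \<noteq> v"
  shows "measure_pmf.prob (kronecker_graph n (kron_matrix \<alpha> \<beta> \<gamma>)) {E. {u, v} \<in> E}
           = kron_prob n (kron_matrix \<alpha> \<beta> \<gamma>) u v"
proof -
  let ?P = "kron_matrix \<alpha> \<beta> \<gamma>"
  let ?Q = "Pi_pmf (kron_pairs n) False (\<lambda>e. bernoulli_pmf (kron_pair_prob n ?P e))"
  have e: "{u, v} \<in> kron_pairs n"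
    using assms by (simp add: kron_pairs_def)
  have q: "kron_pair_prob n ?P {u, v} = kron_prob n ?P u v"
    by (rule kron_pair_prob_doubleton) (rule kron_matrix_commute)
  have b: "0 \<le> kron_prob n ?P u v" "kron_prob n ?P u v \<le> 1"
    using assms unfolding kron_prob_def kron_matrix_def
    by (auto intro!: prod_nonneg prod_le_1)
  have "measure_pmf.prob (kronecker_graph n ?P) {E. {u, v} \<in> E}
          = measure_pmf.prob ?Q ((\<lambda>X. X {u, v}) -` {True})"
    using e by (simp add: kronecker_graph_def vimage_def)
  also have "\<dots> = measure_pmf.prob (map_pmf (\<lambda>X. X {u, v}) ?Q) {True}"
    by simp
  also have "\<dots> = pmf (bernoulli_pmf (kron_pair_prob n ?P {u, v})) True"
    using e finite_kron_pairs by (simp add: Pi_pmf_component measure_pmf_single)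
  also have "\<dots> = kron_prob n ?P u v"
    using b q by simp
  finally show ?thesis .
qed

end

theory Submission
  imports Defs "HOL-Real_Asymp.Real_Asymp"
begin

text \<open>
  For \<open>\<alpha> = \<gamma>\<close> every pair at Hamming distance \<open>d\<close> is an edge with the same probability
  \<open>\<beta>^d \<alpha>^(n - d)\<close>, and there are of order \<open>2^n (n choose d)\<close> such pairs. By independence no such
  pair is an edge with probability at most \<open>exp (- E / 4)\<close>, where
  \<open>E = 2^n (n choose d) \<beta>^d \<alpha>^(n - d)\<close>, so it suffices that \<open>E\<close> tends to infinity.

  Up to a factor \<open>n + 1\<close>, \<open>E\<close> equals \<open>exp (n g(d/n))\<close> with the concave function
  \<open>g x = ln 2 + x ln (\<beta>/x) + (1 - x) ln (\<alpha>/(1 - x))\<close>. The choice of \<open>c\<close> means \<open>g c = 0\<close>.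
  If \<open>\<alpha> < 1/2\<close> then \<open>\<beta> > 1/2\<close>, so \<open>g 1 = ln (2 \<beta>) > 0\<close> and by concavity \<open>n g(d/n)\<close> is at least a
  positive multiple of \<open>d - c n\<close>, i.e. of order \<open>ln\<^sup>2 n\<close>, which beats \<open>ln (n + 1)\<close>. The case \<open>\<beta> < 1/2\<close>
  is the same with \<open>\<alpha>, \<beta>\<close> exchanged, \<open>c\<close> replaced by \<open>1 - c\<close> and \<open>d\<close> by \<open>n - d\<close>.
\<close>

section \<open>The largest term of a binomial expansion\<close>

lemma binomial_term_Suc:
  fixes x y :: real
  assumes "j < n"
  shows "real (Suc j) * y * (real (n choose Suc j) * x ^ Suc j * y ^ (n - Suc j))
       = real (n - j) * x * (real (n choose j) * x ^ j * y ^ (n - j))"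
proof -
  have "Suc j * (n choose Suc j) = (n - j) * (n choose j)"
    using binomial_absorb_comp[of n j] binomial_absorption[of j n] assms
    by (metis binomial_absorb_comp binomial_absorption)
  then have b: "real (Suc j) * real (n choose Suc j) = real (n - j) * real (n choose j)"
    by (metis of_nat_mult)
  have "n - j = Suc (n - Suc j)"
    using assms by simp
  then have y: "y ^ (n - j) = y * y ^ (n - Suc j)"
    by simp
  have "real (Suc j) * y * (real (n choose Suc j) * x ^ Suc j * y ^ (n - Suc j))
      = (real (Suc j) * real (n choose Suc j)) * (x ^ j * x * (y * y ^ (n - Suc j)))"
    by simp
  also have "\<dots> = real (n - j) * x * (real (n choose j) * x ^ j * y ^ (n - j))"
    unfolding b y by simp
  finally show ?thesis .
qed

text \<open>Divided by \<open>n ^ n\<close>, \<open>t\<close> is the binomial distribution with mean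
  \<open>k\<close>. The ratio of \<open>t (j + 1)\<close> to \<open>t j\<close> is
  \<open>(n - j) k / ((j + 1) (n - k))\<close>, at least 1 for \<open>j < k\<close> and at most 1
  for \<open>j \<ge> k\<close>, so \<open>t\<close> rises up to \<open>k\<close> and then
  falls.\<close>

lemma binomial_term_le_mode:
  fixes k n j :: nat
  assumes k: "0 < k" "k < n" and j: "j \<le> n"
  defines "t \<equiv> \<lambda>j. real (n choose j) * real k ^ j * real (n - k) ^ (n - j)"
  shows "t j \<le> t k"
proof (cases "j \<le> k")
  case True
  then show ?thesis
  proof (induction rule: inc_induct)
    case base
    show ?case by simp
  next
    case (step i)
    have eq: "real (Suc i) * real (n - k) * t (Suc i) = real (n - i) * real k * t i"
      unfolding t_def by (rule binomial_term_Suc) (use k step.hyps in simp)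
    have "real (Suc i) * real (n - k) \<le> real (n - i) * real k"
    proof -
      have "real n * (real i + 1) \<le> real n * real k"
        using step.hyps by (intro mult_left_mono) auto
      then show ?thesis
        using k step.hyps by (simp add: of_nat_diff algebra_simps)
    qed
    then have "real (n - i) * real k * t i \<ge> real (Suc i) * real (n - k) * t i"
      unfolding t_def by (intro mult_right_mono) auto
    then have "real (Suc i) * real (n - k) * t i \<le> real (Suc i) * real (n - k) * t (Suc i)"
      unfolding eq .
    then have "t i \<le> t (Suc i)"
      using k by (subst (asm) mult_le_cancel_left_pos) auto
    then show ?case using step.IH by simp
  qed
next
  case False
  then have "k \<le> j" by simp
  then show ?thesis using j
  proof (induction rule: dec_induct)
    case base
    show ?case by simp
  next
    case (step i)
    have eq: "real (Suc i) * real (n - k) * t (Suc i) = real (n - i) * real k * t i"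
      unfolding t_def by (rule binomial_term_Suc) (use step.prems in simp)
    have "real (n - i) * real k \<le> real (Suc i) * real (n - k)"
    proof -
      have "real n * real k + real k \<le> real n * real i + real n"
        using k step.hyps by (intro add_mono mult_left_mono) auto
      then show ?thesis
        using k step.prems by (simp add: of_nat_diff algebra_simps)
    qed
    then have "real (n - i) * real k * t i \<le> real (Suc i) * real (n - k) * t i"
      unfolding t_def by (intro mult_right_mono) auto
    then have "real (Suc i) * real (n - k) * t (Suc i) \<le> real (Suc i) * real (n - k) * t i"
      unfolding eq .
    then have "t (Suc i) \<le> t i"
      using k by (subst (asm) mult_le_cancel_left_pos) auto
    then show ?case using step.IH step.prems by simp
  qed
qed

text \<open>\<open>(k + (n - k)) ^ n\<close> expands into \<open>n + 1\<close> terms, none above the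
  \<open>k\<close>-th. This stands in for Stirling's formula, at the price of the factor
  \<open>n + 1\<close>.\<close>

lemma power_le_binomial_mode:
  fixes k n :: nat
  assumes "0 < k" "k < n"
  shows "real n ^ n \<le> real (n + 1) * (real (n choose k) * real k ^ k * real (n - k) ^ (n - k))"
proof -
  have "real n ^ n = (real k + real (n - k)) ^ n"
    using assms by simp
  also have "\<dots> = (\<Sum>j\<le>n. real (n choose j) * real k ^ j * real (n - k) ^ (n - j))"
    by (rule binomial_ring)
  also have "\<dots> \<le> (\<Sum>j\<le>n. real (n choose k) * real k ^ k * real (n - k) ^ (n - k))"
    using assms by (intro sum_mono binomial_term_le_mode) auto
  finally show ?thesis by simp
qed

section \<open>Exponential growth of the edge expectation\<close>

text \<open>Concavity between \<open>c\<close> and \<open>1\<close> of the exponent \<open>g\<close> described above; the weight of \<open>1\<close> in the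
  convex combination \<open>x\<close> is \<open>(x - c) / (1 - c)\<close>.\<close>

lemma exponent_ge_chord:
  fixes a b c x :: real
  assumes pos: "0 < a" "0 < b" and c: "0 < c" and x: "c \<le> x" "x < 1"
    and zero: "ln 2 + c * ln (b / c) + (1 - c) * ln (a / (1 - c)) = 0"
  shows "(x - c) / (1 - c) * ln (2 * b) \<le> ln 2 + x * ln (b / x) + (1 - x) * ln (a / (1 - x))"
proof -
  define l where "l = (x - c) / (1 - c)"
  have c1: "c < 1" using x by simp
  have l: "0 \<le> l" "l < 1" and om: "1 - x = (1 - l) * (1 - c)"
    unfolding l_def using x c c1 by (auto simp: field_simps)
  have x_eq: "x = l + (1 - l) * c" using om by (simp add: algebra_simps)
  have x0: "0 < x" using c x by simp
  have lom: "ln (1 - x) = ln (1 - l) + ln (1 - c)"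
    unfolding om using l c1 by (simp add: ln_mult)
  have z: "ln 2 + c * (ln b - ln c) + (1 - c) * (ln a - ln (1 - c)) = 0"
    using zero pos c c1 by (simp add: ln_div)
  \<comment> \<open>Concavity is obtained by hand from \<open>ln t \<le> t - 1\<close> at
    \<open>t = x / c\<close>, \<open>t = x\<close> and \<open>t = 1 - l\<close>; the weighted
    right-hand sides add up to \<open>l * (x - 1) \<le> 0\<close>.\<close>
  have i1: "(1 - l) * c * (ln x - ln c) \<le> (1 - l) * c * (x / c - 1)"
    using l c x0 ln_le_minus_one[of "x / c"]
    by (intro mult_left_mono) (auto simp: ln_div)
  have i2: "l * ln x \<le> l * (x - 1)"
    using l x0 ln_le_minus_one[of x] by (intro mult_left_mono) auto
  have i3: "(1 - x) * ln (1 - l) \<le> (1 - x) * (- l)"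
    using l x ln_le_minus_one[of "1 - l"] by (intro mult_left_mono) auto
  have "(1 - l) * c * (x / c - 1) + l * (x - 1) + (1 - x) * (- l) = l * (x - 1)"
  proof -
    have "(1 - l) * c * (x / c - 1) = (1 - l) * x - (1 - l) * c"
      using c by (simp add: field_simps)
    then show ?thesis using x_eq by algebra
  qed
  moreover have "l * (x - 1) \<le> 0"
    using l x by (intro mult_nonneg_nonpos) auto
  ultimately have
    key: "(1 - l) * c * (ln x - ln c) + l * ln x + (1 - x) * ln (1 - l) \<le> 0"
    using i1 i2 i3 by linarith
  \<comment> \<open>Subtracting \<open>1 - l\<close> times the vanishing value of \<open>g\<close>
    at \<open>c\<close> cancels all terms in \<open>ln 2\<close>, \<open>ln a\<close> and
    \<open>ln b\<close>.\<close>
  have "ln 2 + x * ln (b / x) + (1 - x) * ln (a / (1 - x)) - l * ln (2 * b)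
      = ln 2 + x * (ln b - ln x) + (1 - x) * (ln a - ln (1 - l) - ln (1 - c)) - l * (ln 2 + ln b)
        - (1 - l) * (ln 2 + c * (ln b - ln c) + (1 - c) * (ln a - ln (1 - c)))"
    unfolding z using pos x x0 lom by (simp add: ln_div ln_mult)
  also have "\<dots> = - ((1 - l) * c * (ln x - ln c) + l * ln x + (1 - x) * ln (1 - l))"
    using om x_eq by algebra
  finally show ?thesis
    using key unfolding l_def by linarith
qed

text \<open>With \<open>x = k / n\<close> the right-hand side is \<open>exp (n g(x))\<close> times
  \<open>B\<close>, a binomial probability at its mode and hence at least
  \<open>1 / (n + 1)\<close>. The chord bound controls the exponential.\<close>

lemma expected_edges_ge:
  fixes a b c :: real and k n :: nat
  assumes pos: "0 < a" "0 < b" and c: "0 < c" and k: "k < n" "c * real n \<le> real k"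
    and zero: "ln 2 + c * ln (b / c) + (1 - c) * ln (a / (1 - c)) = 0"
  shows "exp (ln (2 * b) / (1 - c) * (real k - c * real n)) / (real n + 1)
           \<le> 2 ^ n * real (n choose k) * b ^ k * a ^ (n - k)"
proof -
  define x where "x = real k / real n"
  define B where "B = real (n choose k) * x ^ k * (1 - x) ^ (n - k)"
  have n: "0 < n" using k by simp
  then have "0 < c * real n" using c by simp
  then have k0: "0 < k" using k by (cases k) auto
  have x: "c \<le> x" "0 < x" "x < 1" and omx: "1 - x = real (n - k) / real n"
    unfolding x_def using k k0 n by (auto simp: field_simps of_nat_diff)
  have "real n ^ n = real n ^ k * real n ^ (n - k)"
    using k by (simp flip: power_add)
  then have "B = real (n choose k) * real k ^ k * real (n - k) ^ (n - k) / real n ^ n"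
    unfolding B_def omx by (simp add: x_def power_divide)
  then have "real n ^ n * 1 \<le> real n ^ n * (real (n + 1) * B)"
    using power_le_binomial_mode[OF k0 k(1)] n by simp
  then have "1 \<le> real (n + 1) * B"
    using n by (subst (asm) mult_le_cancel_left_pos) auto
  then have B: "1 / (real n + 1) \<le> B"
    by (simp add: field_simps)
  have kx: "real k = real n * x" and nkx: "real (n - k) = real n * (1 - x)"
    unfolding omx using n by (auto simp: x_def)
  have "ln (2 * b) / (1 - c) * (real k - c * real n)
      = real n * ((x - c) / (1 - c) * ln (2 * b))"
    unfolding kx by (simp add: field_simps)
  also have "\<dots> \<le> real n * (ln 2 + x * ln (b / x) + (1 - x) * ln (a / (1 - x)))"
    using exponent_ge_chord[OF pos c x(1) x(3) zero] by (intro mult_left_mono) auto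
  also have "\<dots> = real n * ln 2 + real k * ln (b / x) + real (n - k) * ln (a / (1 - x))"
    unfolding kx nkx by (simp add: algebra_simps)
  finally have "exp (ln (2 * b) / (1 - c) * (real k - c * real n))
      \<le> exp (real n * ln 2 + real k * ln (b / x) + real (n - k) * ln (a / (1 - x)))"
    by simp
  also have "\<dots> = 2 ^ n * (b / x) ^ k * (a / (1 - x)) ^ (n - k)"
    using pos x by (simp add: exp_add exp_of_nat_mult)
  finally have "exp (ln (2 * b) / (1 - c) * (real k - c * real n)) * (1 / (real n + 1))
      \<le> 2 ^ n * (b / x) ^ k * (a / (1 - x)) ^ (n - k) * B"
    using B pos x by (intro mult_mono) auto
  also have "\<dots> = 2 ^ n * real (n choose k) * b ^ k * a ^ (n - k)"
    using x unfolding B_def by (simp add: power_divide)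
  finally show ?thesis by simp
qed

lemma expected_edges_at_top:
  fixes a b c :: real and k :: "nat \<Rightarrow> nat"
  assumes pos: "0 < a" and b: "1 / 2 < b" and c: "0 < c" "c < 1"
    and half: "(b / c) powr c * (a / (1 - c)) powr (1 - c) = 1 / 2"
    and k: "\<forall>\<^sub>F n in sequentially. k n < n \<and> c * real n + (ln (real n))\<^sup>2 - 1 \<le> real (k n)"
  shows "filterlim (\<lambda>n. 2 ^ n * real (n choose k n) * b ^ k n * a ^ (n - k n)) at_top sequentially"
proof -
  define \<delta> where "\<delta> = ln (2 * b) / (1 - c)"
  have \<delta>: "0 < \<delta>" unfolding \<delta>_def using b c by simp
  have "ln ((b / c) powr c * (a / (1 - c)) powr (1 - c))
      = c * ln (b / c) + (1 - c) * ln (a / (1 - c))"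
    using pos b c by (simp add: ln_mult ln_powr)
  then have zero: "ln 2 + c * ln (b / c) + (1 - c) * ln (a / (1 - c)) = 0"
    unfolding half by (simp add: ln_div)
  \<comment> \<open>\<open>exp (\<delta> * (ln n)^2)\<close> is
    \<open>n powr (\<delta> * ln n)\<close>, which outgrows every fixed power of
    \<open>n\<close>.\<close>
  have "filterlim (\<lambda>n. exp (\<delta> * ((ln (real n))\<^sup>2 - 1)) / (real n + 1)) at_top sequentially"
    using \<delta> by real_asymp
  \<comment> \<open>This keeps \<open>k n\<close> to the right of \<open>c * n\<close>, where the
    chord bound applies, despite the 1 lost to rounding.\<close>
  moreover have "\<forall>\<^sub>F n in sequentially. (ln (real n))\<^sup>2 \<ge> 1"
    by real_asymp
  with k have "\<forall>\<^sub>F n in sequentially. exp (\<delta> * ((ln (real n))\<^sup>2 - 1)) / (real n + 1)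
      \<le> 2 ^ n * real (n choose k n) * b ^ k n * a ^ (n - k n)"
  proof eventually_elim
    case (elim n)
    have "exp (\<delta> * ((ln (real n))\<^sup>2 - 1)) / (real n + 1)
        \<le> exp (\<delta> * (real (k n) - c * real n)) / (real n + 1)"
      using elim \<delta> by (intro divide_right_mono) auto
    also have "\<dots> \<le> 2 ^ n * real (n choose k n) * b ^ k n * a ^ (n - k n)"
      unfolding \<delta>_def using elim pos b c zero by (intro expected_edges_ge) auto
    finally show ?case .
  qed
  ultimately show ?thesis by (rule filterlim_at_top_mono)
qed

section \<open>Pairs at a given Hamming distance\<close>

lemma kron_prob_hamming:
  "kron_prob n (kron_matrix \<alpha> \<beta> \<alpha>) u v = \<beta> ^ hamming n u v * \<alpha> ^ (n - hamming n u v)"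
proof -
  let ?D = "{k \<in> {1..n}. u k \<noteq> v k}"
  have "kron_matrix \<alpha> \<beta> \<alpha> i j = (if i \<noteq> j then \<beta> else \<alpha>)" for i j
    by (cases i; cases j) (auto simp: kron_matrix_def)
  then have "kron_prob n (kron_matrix \<alpha> \<beta> \<alpha>) u v = (\<Prod>k\<in>{1..n}. if u k \<noteq> v k then \<beta> else \<alpha>)"
    by (simp add: kron_prob_def)
  also have "\<dots> = \<beta> ^ card ?D * \<alpha> ^ card ({1..n} - ?D)"
    by (subst prod.If_cases) (auto intro!: arg_cong2[where f = "(*)"] arg_cong2[where f = "(^)"]
        arg_cong[where f = card])
  also have "card ({1..n} - ?D) = n - card ?D"
    by (subst card_Diff_subset) auto
  finally show ?thesis by (simp add: hamming_def)
qed

lemma card_hamming_sphere_ge: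
  assumes u: "u \<in> kron_vertices n"
  shows "n choose d \<le> card {w \<in> kron_vertices n. hamming n u w = d}"
proof -
  \<comment> \<open>Adding 1 in \<open>bit\<close> flips a digit, so \<open>?F D\<close> differs
    from \<open>u\<close> exactly on \<open>D\<close>, and \<open>D\<close> can be read off from
    \<open>?F D\<close>.\<close>
  let ?F = "\<lambda>D. \<lambda>k\<in>{1..n}. if k \<in> D then u k + 1 else u k"
  let ?A = "{D. D \<subseteq> {1..n} \<and> card D = d}"
  have diff: "{k \<in> {1..n}. u k \<noteq> ?F D k} = D" if "D \<subseteq> {1..n}" for D
    using that by auto
  have "inj_on ?F ?A"
  proof (rule inj_onI)
    fix D D' assume D: "D \<in> ?A" "D' \<in> ?A" and eq: "?F D = ?F D'"
    have "D = {k \<in> {1..n}. u k \<noteq> ?F D k}" by (rule diff[symmetric]) (use D in auto)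
    also have "\<dots> = {k \<in> {1..n}. u k \<noteq> ?F D' k}" by (simp only: eq)
    also have "\<dots> = D'" by (rule diff) (use D in auto)
    finally show "D = D'" .
  qed
  moreover have "?F ` ?A \<subseteq> {w \<in> kron_vertices n. hamming n u w = d}"
  proof
    fix w assume "w \<in> ?F ` ?A"
    then obtain D where D: "D \<subseteq> {1..n}" "card D = d" "w = ?F D" by blast
    have "hamming n u w = d" unfolding hamming_def D(3) diff[OF D(1)] by (rule D(2))
    moreover have "w \<in> kron_vertices n" unfolding D(3) kron_vertices_def by simp
    ultimately show "w \<in> {w \<in> kron_vertices n. hamming n u w = d}" by simp
  qed
  ultimately have "card ?A \<le> card {w \<in> kron_vertices n. hamming n u w = d}"
    by (rule card_inj_on_le) (simp add: finite_kron_vertices)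
  then show ?thesis by (simp add: n_subsets)
qed

definition pairs_at_distance :: "nat \<Rightarrow> nat \<Rightarrow> (nat \<Rightarrow> bit) set set" where
  "pairs_at_distance n d =
     {{u, w} | u w. u \<in> kron_vertices n \<and> w \<in> kron_vertices n \<and> hamming n u w = d}"

lemma pairs_at_distance_subset:
  assumes "0 < d"
  shows "pairs_at_distance n d \<subseteq> kron_pairs n"
proof
  fix e assume "e \<in> pairs_at_distance n d"
  then obtain u w where e: "e = {u, w}" "u \<in> kron_vertices n" "w \<in> kron_vertices n"
    "hamming n u w = d"
    by (auto simp: pairs_at_distance_def)
  moreover have "u \<noteq> w" using e(4) assms by (auto simp: hamming_def)
  ultimately show "e \<in> kron_pairs n" by (auto simp: kron_pairs_def)
qed

text \<open>Each ordered pair \<open>(u, w)\<close> at distance \<open>d\<close> lies in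
  \<open>e \<times> e\<close> for \<open>e = {u, w}\<close>, a set of 4 elements. Excluding the
  diagonal would give 2; a constant factor is harmless for the limit.\<close>

lemma card_pairs_at_distance_ge:
  assumes "0 < d"
  shows "2 ^ n * (n choose d) \<le> 4 * card (pairs_at_distance n d)"
proof -
  let ?S = "pairs_at_distance n d"
  let ?T = "SIGMA u : kron_vertices n. {w \<in> kron_vertices n. hamming n u w = d}"
  have fin: "finite ?S"
    using pairs_at_distance_subset[OF assms] finite_kron_pairs by (rule finite_subset)
  have card2: "card e = 2" if "e \<in> ?S" for e
    using pairs_at_distance_subset[OF assms] that by (auto simp: kron_pairs_def)
  have "2 ^ n * (n choose d) = (\<Sum>u\<in>kron_vertices n. n choose d)"
    by (simp add: card_kron_vertices)
  also have "\<dots> \<le> (\<Sum>u\<in>kron_vertices n. card {w \<in> kron_vertices n. hamming n u w = d})"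
    by (intro sum_mono card_hamming_sphere_ge)
  also have "\<dots> = card ?T"
    by (simp add: finite_kron_vertices)
  also have "\<dots> \<le> card (\<Union>e\<in>?S. e \<times> e)"
  proof (rule card_mono)
    show "finite (\<Union>e\<in>?S. e \<times> e)"
      using fin card2 by (auto intro!: finite_cartesian_product intro: card_ge_0_finite)
    show "?T \<subseteq> (\<Union>e\<in>?S. e \<times> e)"
      unfolding pairs_at_distance_def by blast
  qed
  also have "\<dots> \<le> (\<Sum>e\<in>?S. card (e \<times> e))"
    by (rule card_UN_le[OF fin])
  also have "\<dots> = 4 * card ?S"
    using card2 by (simp add: card_cartesian_product)
  finally show ?thesis .
qed

section \<open>Independence of the edges\<close>

text \<open>The event fixes the value \<open>False\<close> on \<open>S\<close> and leaves all other
  pairs free, so it is a box for the product law, and free pairs contribute the factor 1.\<close>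

lemma prob_no_edge_in:
  assumes S: "S \<subseteq> kron_pairs n" and p: "0 \<le> p" "p \<le> 1"
    and eq: "\<And>e. e \<in> S \<Longrightarrow> kron_pair_prob n P e = p"
  shows "measure_pmf.prob (kronecker_graph n P) {E. S \<inter> E = {}} = (1 - p) ^ card S"
proof -
  let ?Q = "Pi_pmf (kron_pairs n) False (\<lambda>e. bernoulli_pmf (kron_pair_prob n P e))"
  let ?B = "\<lambda>e. if e \<in> S then {False} else UNIV"
  have "measure_pmf.prob (kronecker_graph n P) {E. S \<inter> E = {}}
      = measure_pmf.prob ?Q (Pi (kron_pairs n) ?B)"
    using S unfolding kronecker_graph_def measure_map_pmf
    by (intro arg_cong[where f = "measure_pmf.prob ?Q"]) (auto simp: Pi_iff split: if_splits)
  also have "\<dots> = (\<Prod>e\<in>kron_pairs n. measure_pmf.prob (bernoulli_pmf (kron_pair_prob n P e)) (?B e))"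
    by (rule measure_Pi_pmf_Pi[OF finite_kron_pairs])
  also have "\<dots> = (\<Prod>e\<in>S. measure_pmf.prob (bernoulli_pmf (kron_pair_prob n P e)) (?B e))"
    by (rule prod.mono_neutral_right[OF finite_kron_pairs S]) simp
  also have "\<dots> = (\<Prod>e\<in>S. 1 - p)"
    using p eq by (intro prod.cong) (auto simp: measure_pmf_single)
  finally show ?thesis by simp
qed

lemma prob_has_edge_at_distance_ge:
  assumes \<alpha>: "0 < \<alpha>" "\<alpha> < 1" and \<beta>: "0 < \<beta>" "\<beta> < 1" and d: "0 < d"
  shows "1 - exp (- (2 ^ n * real (n choose d) * \<beta> ^ d * \<alpha> ^ (n - d) / 4))
     \<le> measure_pmf.prob (kronecker_graph n (kron_matrix \<alpha> \<beta> \<alpha>)) {E. has_edge_at_distance n (int d) E}"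
proof -
  let ?P = "kron_matrix \<alpha> \<beta> \<alpha>" and ?S = "pairs_at_distance n d"
  let ?M = "kronecker_graph n ?P"
  define p where "p = \<beta> ^ d * \<alpha> ^ (n - d)"
  have p: "0 \<le> p" "p \<le> 1"
    unfolding p_def using \<alpha> \<beta> by (auto intro!: mult_le_one power_le_one)
  have eq: "kron_pair_prob n ?P e = p" if eS: "e \<in> ?S" for e
  proof -
    obtain u w where e: "e = {u, w}" "hamming n u w = d"
      using eS by (auto simp: pairs_at_distance_def)
    have "kron_pair_prob n ?P e = kron_prob n ?P u w"
      unfolding e(1) by (rule kron_pair_prob_doubleton) (rule kron_matrix_commute)
    then show ?thesis by (simp add: kron_prob_hamming e(2) p_def)
  qed
  have compl: "- {E. ?S \<inter> E = {}} = {E. has_edge_at_distance n (int d) E}"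
    unfolding pairs_at_distance_def has_edge_at_distance_def by auto
  have "real (2 ^ n * (n choose d)) \<le> real (4 * card ?S)"
    using card_pairs_at_distance_ge[OF d] by (simp only: of_nat_le_iff)
  then have "2 ^ n * real (n choose d) * p \<le> 4 * real (card ?S) * p"
    using p by (intro mult_right_mono) auto
  then have card: "2 ^ n * real (n choose d) * \<beta> ^ d * \<alpha> ^ (n - d) / 4 \<le> real (card ?S) * p"
    unfolding p_def by (simp add: mult_ac)
  have "measure_pmf.prob ?M {E. ?S \<inter> E = {}} = (1 - p) ^ card ?S"
    by (rule prob_no_edge_in[OF pairs_at_distance_subset[OF d] p eq])
  \<comment> \<open>\<open>1 - p \<le> exp (- p)\<close> brings in the expected number
    \<open>card ?S * p\<close> of edges in \<open>?S\<close>.\<close>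
  also have "\<dots> \<le> exp (- p) ^ card ?S"
    using p exp_ge_add_one_self[of "- p"] by (intro power_mono) auto
  also have "\<dots> = exp (- (real (card ?S) * p))"
    by (simp flip: exp_of_nat_mult)
  also have "\<dots> \<le> exp (- (2 ^ n * real (n choose d) * \<beta> ^ d * \<alpha> ^ (n - d) / 4))"
    using card by simp
  finally show ?thesis
    unfolding compl[symmetric] using measure_pmf.prob_compl[of "{E. ?S \<inter> E = {}}" ?M]
    by (simp add: Compl_eq_Diff_UNIV)
qed

section \<open>Limits along the two sequences of distances\<close>

text \<open>For small \<open>n\<close> a rounded distance may fail to be positive, so positivity is
  asked only eventually; from then on \<open>nat (d n)\<close> loses nothing.\<close>

lemma aas_has_edge_at_distance:
  fixes d :: "nat \<Rightarrow> int"
  assumes \<alpha>: "0 < \<alpha>" "\<alpha> < 1" and \<beta>: "0 < \<beta>" "\<beta> < 1"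
    and d: "\<forall>\<^sub>F n in sequentially. 0 < d n"
    and lim: "filterlim (\<lambda>n. 2 ^ n * real (n choose nat (d n)) * \<beta> ^ nat (d n) * \<alpha> ^ (n - nat (d n)))
                at_top sequentially"
  shows "aas (\<lambda>n. kronecker_graph n (kron_matrix \<alpha> \<beta> \<alpha>)) (\<lambda>n. has_edge_at_distance n (d n))"
  unfolding aas_def
proof (rule tendsto_sandwich)
  let ?E = "\<lambda>n. 2 ^ n * real (n choose nat (d n)) * \<beta> ^ nat (d n) * \<alpha> ^ (n - nat (d n))"
  show "\<forall>\<^sub>F n in sequentially. 1 - exp (- (?E n / 4))
      \<le> measure_pmf.prob (kronecker_graph n (kron_matrix \<alpha> \<beta> \<alpha>)) {G. has_edge_at_distance n (d n) G}"
    using d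
  proof eventually_elim
    case (elim n)
    then show ?case
      using prob_has_edge_at_distance_ge[OF \<alpha> \<beta>, of "nat (d n)" n] by simp
  qed
  show "\<forall>\<^sub>F n in sequentially.
      measure_pmf.prob (kronecker_graph n (kron_matrix \<alpha> \<beta> \<alpha>)) {G. has_edge_at_distance n (d n) G} \<le> 1"
    by simp
  have "((\<lambda>x::real. 1 - exp (- (x / 4))) \<longlongrightarrow> 1) at_top"
    by real_asymp
  from filterlim_compose[OF this lim] show "(\<lambda>n. 1 - exp (- (?E n / 4))) \<longlonglongrightarrow> 1" .
  show "(\<lambda>n. 1) \<longlonglongrightarrow> (1::real)" by simp
qed

theorem theorem19:
  fixes \<alpha> \<beta> \<gamma> c :: real
  assumes "0 < \<alpha>" "\<alpha> < 1" "0 < \<beta>" "\<beta> < 1" "0 < \<gamma>" "\<gamma> < 1"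
    and "\<alpha> = \<gamma>" "\<alpha> + \<beta> > 1"
    and "0 < c" "c < 1"
    and "(\<beta> / c) powr c * (\<alpha> / (1 - c)) powr (1 - c) = 1 / 2"
  shows "(\<alpha> < 1 / 2 \<longrightarrow>
            (\<forall>d. is_rounding d (\<lambda>n. c * real n + (ln (real n))\<^sup>2) \<longrightarrow>
               aas (\<lambda>n. kronecker_graph n (kron_matrix \<alpha> \<beta> \<gamma>))
                   (\<lambda>n. has_edge_at_distance n (d n)))) \<and>
         (\<beta> < 1 / 2 \<longrightarrow>
            (\<forall>d. is_rounding d (\<lambda>n. c * real n - (ln (real n))\<^sup>2) \<longrightarrow>
               aas (\<lambda>n. kronecker_graph n (kron_matrix \<alpha> \<beta> \<gamma>))
                   (\<lambda>n. has_edge_at_distance n (d n))))"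
proof -
  \<comment> \<open>Either rounding moves \<open>x n\<close> by less than 1, which is the 1
    subtracted in \<open>expected_edges_at_top\<close>.\<close>
  have round: "x n - 1 < of_int (d n) \<and> of_int (d n) < x n + 1" if "is_rounding d x" for d x n
  proof -
    have "d n = \<lfloor>x n\<rfloor> \<or> d n = \<lceil>x n\<rceil>"
      using that by (simp add: is_rounding_def)
    then show ?thesis by linarith
  qed
  have plus: "aas (\<lambda>n. kronecker_graph n (kron_matrix \<alpha> \<beta> \<alpha>)) (\<lambda>n. has_edge_at_distance n (d n))"
    if "\<alpha> < 1 / 2" and rd: "is_rounding d (\<lambda>n. c * real n + (ln (real n))\<^sup>2)" for d
  proof (rule aas_has_edge_at_distance)
    have "\<forall>\<^sub>F n in sequentially. c * real n + (ln (real n))\<^sup>2 - 1 > 0"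
      using \<open>0 < c\<close> by real_asymp
    then show d0: "\<forall>\<^sub>F n in sequentially. 0 < d n"
    proof eventually_elim
      case (elim n)
      then show ?case using round[OF rd, of n] by linarith
    qed
    have "\<forall>\<^sub>F n in sequentially. c * real n + (ln (real n))\<^sup>2 + 1 < real n"
      using \<open>c < 1\<close> by real_asymp
    with d0 have "\<forall>\<^sub>F n in sequentially. nat (d n) < n \<and>
        c * real n + (ln (real n))\<^sup>2 - 1 \<le> real (nat (d n))"
    proof eventually_elim
      case (elim n)
      then show ?case using round[OF rd, of n] by auto
    qed
    \<comment> \<open>The required \<open>1 / 2 < \<beta>\<close> comes from
      \<open>\<alpha> < 1 / 2\<close> and \<open>\<alpha> + \<beta> > 1\<close>.\<close>
    then show "filterlim (\<lambda>n. 2 ^ n * real (n choose nat (d n)) * \<beta> ^ nat (d n) * \<alpha> ^ (n - nat (d n)))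
        at_top sequentially"
      using assms that by (intro expected_edges_at_top) auto
  qed (use assms in auto)
  have minus: "aas (\<lambda>n. kronecker_graph n (kron_matrix \<alpha> \<beta> \<alpha>)) (\<lambda>n. has_edge_at_distance n (d n))"
    if "\<beta> < 1 / 2" and rd: "is_rounding d (\<lambda>n. c * real n - (ln (real n))\<^sup>2)" for d
  proof (rule aas_has_edge_at_distance)
    have "\<forall>\<^sub>F n in sequentially. c * real n - (ln (real n))\<^sup>2 - 1 > 0"
      using \<open>0 < c\<close> by real_asymp
    then show d0: "\<forall>\<^sub>F n in sequentially. 0 < d n"
    proof eventually_elim
      case (elim n)
      then show ?case using round[OF rd, of n] by linarith
    qed
    have "\<forall>\<^sub>F n in sequentially. c * real n - (ln (real n))\<^sup>2 + 1 < real n"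
      using \<open>c < 1\<close> by real_asymp
    \<comment> \<open>Positivity of \<open>d n\<close> gives \<open>n - nat (d n) < n\<close>, and
      \<open>nat (d n) < n\<close> keeps the truncated subtraction exact.\<close>
    with d0 have ev: "\<forall>\<^sub>F n in sequentially. nat (d n) < n \<and> n - nat (d n) < n \<and>
        (1 - c) * real n + (ln (real n))\<^sup>2 - 1 \<le> real (n - nat (d n))"
    proof eventually_elim
      case (elim n)
      then have *: "0 < nat (d n)" "nat (d n) < n" "real (nat (d n)) = of_int (d n)"
        using round[OF rd, of n] by auto
      then show ?case
        using round[OF rd, of n] by (simp add: of_nat_diff algebra_simps)
    qed
    \<comment> \<open>Counting agreeing digits instead of differing ones swaps
      \<open>\<alpha>\<close> with \<open>\<beta>\<close> and \<open>c\<close> with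
      \<open>1 - c\<close>, which preserves the equation for \<open>c\<close>. The deficit
      \<open>- (ln n)^2\<close> becomes a surplus, and \<open>\<beta> < 1 / 2\<close> gives
      \<open>1 / 2 < \<alpha>\<close>.\<close>
    have "filterlim (\<lambda>n. 2 ^ n * real (n choose (n - nat (d n))) * \<alpha> ^ (n - nat (d n))
        * \<beta> ^ (n - (n - nat (d n)))) at_top sequentially"
    proof (rule expected_edges_at_top[where c = "1 - c"])
      show "\<forall>\<^sub>F n in sequentially. n - nat (d n) < n \<and>
          (1 - c) * real n + (ln (real n))\<^sup>2 - 1 \<le> real (n - nat (d n))"
        using ev by (rule eventually_mono) blast
    qed (use assms that in \<open>auto simp: mult.commute\<close>)
    moreover have "\<forall>\<^sub>F n in sequentially.
        2 ^ n * real (n choose (n - nat (d n))) * \<alpha> ^ (n - nat (d n)) * \<beta> ^ (n - (n - nat (d n)))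
      = 2 ^ n * real (n choose nat (d n)) * \<beta> ^ nat (d n) * \<alpha> ^ (n - nat (d n))"
      using ev
    proof eventually_elim
      case (elim n)
      then show ?case using binomial_symmetric[of "nat (d n)" n] by simp
    qed
    ultimately show "filterlim (\<lambda>n. 2 ^ n * real (n choose nat (d n)) * \<beta> ^ nat (d n) * \<alpha> ^ (n - nat (d n)))
        at_top sequentially"
      by (simp add: filterlim_cong)
  qed (use assms in auto)
  show ?thesis
    using plus minus \<open>\<alpha> = \<gamma>\<close> by simp
qed

end
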